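(* For every odd positive integer $n$, $$\sigma_{7}(n)=12\left(864\sum_{\substack{i,j,k,l\ge 0\\ i+j+k+l=n}}\widehat{\sigma}(i)\,\widehat{\sigma}(j)\,\widehat{\sigma}(k)\,\widehat{\sigma}(l)-\sum_{\substack{i,j\ge 0\\ i+j=n}}\widehat{\sigma}(i)\,\widetilde{\sigma}_{5}(j)\right),$$ where $\widehat{\sigma}(0)=\tfrac1{24}$ and $\widetilde{\sigma}_{5}(0)=\tfrac18$.
   Context: For integers $n\ge1$, $\sigma_{s}(n)=\sum_{d\mid n}d^{s}$, $\widetilde{\sigma}_{s}(n)=\sum_{d\mid n}(-1)^{d-1}d^{s}$ and $\widehat{\sigma}(n)=\widehat{\sigma}_{1}(n)=\sum_{d\mid n}(-1)^{n/d-1}d$. Values at $0$ are assigned as in the claim. *)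

theory Defs
  imports Complex_Main
begin

definition sigma :: "nat \<Rightarrow> nat \<Rightarrow> real" where
  "sigma s n = (\<Sum>d | d dvd n. real d ^ s)"

text \<open>
  For positive \<open>n\<close> the truncated subtractions in the exponents of the next two definitions
  are exact, since then \<open>d \<ge> 1\<close> and \<open>n div d \<ge> 1\<close>. At \<open>n = 0\<close> the set of divisors is
  infinite and the sums are meaningless; theorems that need a value at \<open>0\<close> override it.
\<close>

definition sigma_tilde :: "nat \<Rightarrow> nat \<Rightarrow> real" where
  "sigma_tilde s n = (\<Sum>d | d dvd n. (-1) ^ (d - 1) * real d ^ s)"

definition sigma_hat :: "nat \<Rightarrow> nat \<Rightarrow> real" where
  "sigma_hat s n = (\<Sum>d | d dvd n. (-1) ^ (n div d - 1) * real d ^ s)"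

end

theory Submission
  imports Defs
begin

text \<open>
  Both convolutions are sums over positive solutions of \<open>a x + b y = n\<close>, which the map
  \<open>(a, b, x, y) \<mapsto> (a - b, b, x, x + y)\<close> carries bijectively from \<open>a > b\<close> to \<open>x < y\<close>. For
  functions \<open>f\<close> that are polynomial in \<open>(a, b)\<close> on each parity class of \<open>(x, y)\<close> this evaluates
  the sum of the difference between \<open>f\<close> and its transform as a combination of divisor sums
  (Skoruppa's method for Eisenstein series). A quadratic \<open>f\<close> shows that the self-convolution of
  \<open>sh\<close> has coefficients given by cubes of divisors. The fourfold sum is then again a twofold
  convolution, and a sextic \<open>f\<close> produces exactly the difference of the two convolutions that
  remain for odd \<open>n\<close>.
\<close>

section \<open>Positive solutions of \<open>a * x + b * y = n\<close>, and sums over them\<close>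

definition quads :: "nat \<Rightarrow> (nat \<times> nat \<times> nat \<times> nat) set" where
  "quads n = {(a, b, x, y). 0 < a \<and> 0 < b \<and> 0 < x \<and> 0 < y \<and> a * x + b * y = n}"

text \<open>Weights take the cofactor as second argument because every sign below depends on its
  parity.\<close>

definition divisor_sum :: "(nat \<Rightarrow> nat \<Rightarrow> real) \<Rightarrow> nat \<Rightarrow> real" where
  "divisor_sum g n = (\<Sum>d | d dvd n. g d (n div d))"

lemma quads_iff [simp]:
  "(a, b, x, y) \<in> quads n \<longleftrightarrow> 0 < a \<and> 0 < b \<and> 0 < x \<and> 0 < y \<and> a * x + b * y = n"
  by (simp add: quads_def)

lemma finite_quads [simp]: "finite (quads n)"
proof (rule finite_subset)
  show "quads n \<subseteq> {..n} \<times> {..n} \<times> {..n} \<times> {..n}"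
  proof
    fix q assume "q \<in> quads n"
    moreover obtain a b x y where q: "q = (a, b, x, y)" by (cases q)
    ultimately have "0 < a" "0 < b" "0 < x" "0 < y" and n: "a * x + b * y = n" by simp_all
    then have "a \<le> a * x" "x \<le> a * x" "b \<le> b * y" "y \<le> b * y" by simp_all
    then have "a \<le> n" "x \<le> n" "b \<le> n" "y \<le> n" using n by linarith+
    then show "q \<in> {..n} \<times> {..n} \<times> {..n} \<times> {..n}" by (simp add: q)
  qed
qed simp

lemma finite_pairs [simp]: "finite {(i, j). i + j = (n::nat)}"
  by (rule finite_subset[of _ "{..n} \<times> {..n}"]) auto

lemma finite_pos_pairs [simp]: "finite {(i, j). 0 < i \<and> 0 < j \<and> i + j = (n::nat)}"
  by (rule finite_subset[of _ "{..n} \<times> {..n}"]) auto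

lemmas finite_pairs_proj [simp] =
  finite_pairs[unfolded case_prod_unfold] finite_pos_pairs[unfolded case_prod_unfold]

lemma sum_quads_swap:
  "(\<Sum>(a, b, x, y) \<in> quads n. f b a y x) = (\<Sum>(a, b, x, y) \<in> quads n. f a b x y)"
  by (rule sum.reindex_bij_witness[where i = "\<lambda>(a, b, x, y). (b, a, y, x)"
        and j = "\<lambda>(a, b, x, y). (b, a, y, x)"]) (auto simp: add.commute)

text \<open>For \<open>x = y\<close> the equation reads \<open>(a + b) * x = n\<close>:
  \<open>d = a + b\<close> runs over the divisors, \<open>x\<close> is its cofactor, and
  \<open>a\<close> is free below \<open>d\<close>.\<close>

lemma sum_quads_equal_cofactors:
  fixes f :: "nat \<Rightarrow> nat \<Rightarrow> nat \<Rightarrow> nat \<Rightarrow> real"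
  assumes "n > 0"
  shows "(\<Sum>(a, b, x, y) \<in> {q \<in> quads n. case q of (a, b, x, y) \<Rightarrow> x = y}. f a b x y)
    = (\<Sum>d | d dvd n. \<Sum>a \<in> {0<..<d}. f a (d - a) (n div d) (n div d))"
proof -
  have "(\<Sum>(a, b, x, y) \<in> {q \<in> quads n. case q of (a, b, x, y) \<Rightarrow> x = y}. f a b x y)
    = (\<Sum>(d, a) \<in> Sigma {d. d dvd n} (\<lambda>d. {0<..<d}). f a (d - a) (n div d) (n div d))"
    by (rule sum.reindex_bij_witness[where i = "\<lambda>(d, a). (a, d - a, n div d, n div d)"
          and j = "\<lambda>(a, b, x, y). (a + b, a)"])
      (use assms in \<open>auto simp: add_mult_distrib[symmetric] dvd_div_eq_0_iff intro!: Nat.gr0I\<close>)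
  then show ?thesis
    using assms by (subst sum.Sigma) (auto simp: case_prod_unfold)
qed

text \<open>Dually, \<open>a = b\<close> gives \<open>a * (x + y) = n\<close>, so \<open>x\<close>
  runs below the cofactor of \<open>a\<close>.\<close>

lemma sum_quads_equal_divisors:
  fixes f :: "nat \<Rightarrow> nat \<Rightarrow> nat \<Rightarrow> nat \<Rightarrow> real"
  assumes "n > 0"
  shows "(\<Sum>(a, b, x, y) \<in> {q \<in> quads n. case q of (a, b, x, y) \<Rightarrow> a = b}. f a b x y)
    = (\<Sum>d | d dvd n. \<Sum>x \<in> {0<..<n div d}. f d d x (n div d - x))"
proof -
  have "(\<Sum>(a, b, x, y) \<in> {q \<in> quads n. case q of (a, b, x, y) \<Rightarrow> a = b}. f a b x y)
    = (\<Sum>(d, x) \<in> Sigma {d. d dvd n} (\<lambda>d. {0<..<n div d}). f d d x (n div d - x))"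
    by (rule sum.reindex_bij_witness[where i = "\<lambda>(d, x). (d, d, x, n div d - x)"
          and j = "\<lambda>(a, b, x, y). (a, x)"])
      (use assms in \<open>auto simp: add_mult_distrib2[symmetric] intro!: Nat.gr0I\<close>)
  then show ?thesis
    using assms by (subst sum.Sigma) (auto simp: case_prod_unfold)
qed

lemma sum_trichotomy:
  fixes u v :: "'a \<Rightarrow> nat" and F :: "'a \<Rightarrow> real"
  assumes "finite A"
  shows "sum F A
    = sum F {q \<in> A. u q = v q} + (sum F {q \<in> A. u q < v q} + sum F {q \<in> A. u q > v q})"
proof -
  have "A = {q \<in> A. u q = v q} \<union> ({q \<in> A. u q < v q} \<union> {q \<in> A. u q > v q})" by auto
  then have "sum F A = sum F \<dots>" by (rule arg_cong)
  also have "\<dots> = sum F {q \<in> A. u q = v q} + sum F ({q \<in> A. u q < v q} \<union> {q \<in> A. u q > v q})"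
    using assms by (intro sum.union_disjoint) auto
  also have "sum F ({q \<in> A. u q < v q} \<union> {q \<in> A. u q > v q})
      = sum F {q \<in> A. u q < v q} + sum F {q \<in> A. u q > v q}"
    using assms by (intro sum.union_disjoint) auto
  finally show ?thesis .
qed

text \<open>
  Since both functions are symmetric, each sum is its diagonal part plus twice the part over
  \<open>x < y\<close>, respectively over \<open>a > b\<close>, and the two parts agree under the bijection.
\<close>
lemma sum_quads_difference:
  fixes f g :: "nat \<Rightarrow> nat \<Rightarrow> nat \<Rightarrow> nat \<Rightarrow> real"
  assumes "n > 0"
    and f_sym: "\<And>a b x y. (a, b, x, y) \<in> quads n \<Longrightarrow> f a b x y = f b a y x"
    and g_sym: "\<And>a b x y. (a, b, x, y) \<in> quads n \<Longrightarrow> g a b x y = g b a y x"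
    and g_f: "\<And>a b x y. (a + b, b, x, y) \<in> quads n \<Longrightarrow> a > 0 \<Longrightarrow>
      g (a + b) b x y = f a b x (x + y)"
  shows "(\<Sum>(a, b, x, y) \<in> quads n. f a b x y - g a b x y)
    = (\<Sum>d | d dvd n. \<Sum>a \<in> {0<..<d}. f a (d - a) (n div d) (n div d))
      - (\<Sum>d | d dvd n. \<Sum>x \<in> {0<..<n div d}. g d d x (n div d - x))"
proof -
  let ?f = "\<lambda>(a, b, x, y). f a b x y" and ?g = "\<lambda>(a, b, x, y). g a b x y"
  let ?fe = "{q \<in> quads n. case q of (a, b, x, y) \<Rightarrow> x = y}"
    and ?fl = "{q \<in> quads n. case q of (a, b, x, y) \<Rightarrow> x < y}"
    and ?fg = "{q \<in> quads n. case q of (a, b, x, y) \<Rightarrow> x > y}"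
  let ?ge = "{q \<in> quads n. case q of (a, b, x, y) \<Rightarrow> a = b}"
    and ?gl = "{q \<in> quads n. case q of (a, b, x, y) \<Rightarrow> a < b}"
    and ?gg = "{q \<in> quads n. case q of (a, b, x, y) \<Rightarrow> a > b}"
  have "sum ?f (quads n) = sum ?f ?fe + (sum ?f ?fl + sum ?f ?fg)"
    using sum_trichotomy[of "quads n" ?f "\<lambda>(a, b, x, y). x" "\<lambda>(a, b, x, y). y"]
    by (simp add: case_prod_unfold)
  also have "sum ?f ?fg = sum ?f ?fl"
    by (rule sum.reindex_bij_witness[where i = "\<lambda>(a, b, x, y). (b, a, y, x)"
          and j = "\<lambda>(a, b, x, y). (b, a, y, x)"]) (auto simp: add.commute f_sym)
  finally have F: "sum ?f (quads n) = sum ?f ?fe + (sum ?f ?fl + sum ?f ?fl)" .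
  have "sum ?g (quads n) = sum ?g ?ge + (sum ?g ?gl + sum ?g ?gg)"
    using sum_trichotomy[of "quads n" ?g "\<lambda>(a, b, x, y). a" "\<lambda>(a, b, x, y). b"]
    by (simp add: case_prod_unfold)
  also have "sum ?g ?gl = sum ?g ?gg"
    by (rule sum.reindex_bij_witness[where i = "\<lambda>(a, b, x, y). (b, a, y, x)"
          and j = "\<lambda>(a, b, x, y). (b, a, y, x)"]) (auto simp: add.commute g_sym)
  finally have G: "sum ?g (quads n) = sum ?g ?ge + (sum ?g ?gg + sum ?g ?gg)" .
  \<comment> \<open>The equation is preserved since
    \<open>(a + b) * x + b * (y - x) = a * x + b * y\<close>.\<close>
  have "sum ?f ?fl = sum ?g ?gg"
  proof (rule sum.reindex_bij_witness[where i = "\<lambda>(a, b, x, y). (a - b, b, x, x + y)"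
          and j = "\<lambda>(a, b, x, y). (a + b, b, x, y - x)"], goal_cases)
    case (2 q)
    then show ?case
      by (auto simp: algebra_simps)
  next
    case (4 q)
    then obtain b c x y where "q = (b + c, b, x, y)" "c > 0" "(b + c, b, x, y) \<in> quads n"
      by (cases q) (auto simp: less_iff_Suc_add)
    then show ?case by (auto simp: algebra_simps)
  next
    case (5 q)
    then obtain a b x z where q: "q = (a, b, x, x + z)" "z > 0" "(a, b, x, x + z) \<in> quads n"
      by (cases q) (auto simp: less_iff_Suc_add)
    then show ?case using g_f[of a b x z] by (auto simp: algebra_simps)
  qed auto
  then show ?thesis
    using F G sum_quads_equal_cofactors[OF assms(1), of f]
      sum_quads_equal_divisors[OF assms(1), of g]
    by (simp add: case_prod_unfold sum_subtractf)
qed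

section \<open>Convolutions and how they split\<close>

lemma convolution_divisor_sum:
  assumes "n > 0"
  shows "(\<Sum>(i, j) \<in> {(i, j). 0 < i \<and> 0 < j \<and> i + j = n}. divisor_sum g i * divisor_sum h j)
    = (\<Sum>(a, b, x, y) \<in> quads n. g a x * h b y)"
proof -
  let ?I = "{(i, j). 0 < i \<and> 0 < j \<and> i + j = n}"
  have "(\<Sum>(i, j) \<in> ?I. divisor_sum g i * divisor_sum h j)
    = (\<Sum>p \<in> ?I. \<Sum>(a, b) \<in> {a. a dvd fst p} \<times> {b. b dvd snd p}.
        g a (fst p div a) * h b (snd p div b))"
    by (rule sum.cong) (auto simp: divisor_sum_def sum_product sum.cartesian_product)
  also have "\<dots> = (\<Sum>((i, j), a, b) \<in> Sigma ?I (\<lambda>p. {a. a dvd fst p} \<times> {b. b dvd snd p}).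
        g a (i div a) * h b (j div b))"
    by (subst sum.Sigma) (auto simp: case_prod_unfold)
  also have "\<dots> = (\<Sum>(a, b, x, y) \<in> quads n. g a x * h b y)"
    by (rule sum.reindex_bij_witness[where i = "\<lambda>(a, b, x, y). ((a * x, b * y), a, b)"
          and j = "\<lambda>((i, j), a, b). (a, b, i div a, j div b)"])
      (auto simp: dvd_div_eq_0_iff intro!: Nat.gr0I)
  finally show ?thesis .
qed

lemma convolution_split_zero:
  fixes F H :: "nat \<Rightarrow> real"
  assumes "n > 0"
  shows "(\<Sum>(i, j) \<in> {(i, j). i + j = n}. F i * H j)
    = F 0 * H n + F n * H 0
      + (\<Sum>(i, j) \<in> {(i, j). 0 < i \<and> 0 < j \<and> i + j = n}. F i * H j)"
proof -
  have "{(i, j). i + j = n} = insert (0, n) (insert (n, 0) {(i, j). 0 < i \<and> 0 < j \<and> i + j = n})"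
    by auto
  then show ?thesis using assms by simp
qed

lemma sum_four_split:
  fixes F :: "nat \<Rightarrow> real"
  shows "(\<Sum>(i, j, k, l) \<in> {(i, j, k, l). i + j + k + l = n}. F i * F j * F k * F l)
    = (\<Sum>(u, v) \<in> {(u, v). u + v = n}.
        (\<Sum>(i, j) \<in> {(i, j). i + j = u}. F i * F j) * (\<Sum>(k, l) \<in> {(k, l). k + l = v}. F k * F l))"
proof -
  let ?A = "\<lambda>u. {(i, j). i + j = (u::nat)}"
  have "(\<Sum>(u, v) \<in> ?A n. (\<Sum>(i, j) \<in> ?A u. F i * F j) * (\<Sum>(k, l) \<in> ?A v. F k * F l))
    = (\<Sum>p \<in> ?A n. \<Sum>((i, j), (k, l)) \<in> ?A (fst p) \<times> ?A (snd p). F i * F j * F k * F l)"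
    by (rule sum.cong)
      (auto simp: sum_product sum.cartesian_product case_prod_unfold mult.assoc)
  also have "\<dots> = (\<Sum>((u, v), (i, j), (k, l)) \<in> Sigma (?A n) (\<lambda>p. ?A (fst p) \<times> ?A (snd p)).
      F i * F j * F k * F l)"
    by (subst sum.Sigma) (auto simp: case_prod_unfold)
  also have "\<dots> = (\<Sum>(i, j, k, l) \<in> {(i, j, k, l). i + j + k + l = n}. F i * F j * F k * F l)"
    by (rule sum.reindex_bij_witness[where i = "\<lambda>(i, j, k, l). ((i + j, k + l), (i, j), (k, l))"
          and j = "\<lambda>((u, v), (i, j), (k, l)). (i, j, k, l)"]) auto
  finally show ?thesis by simp
qed

section \<open>The divisor functions with signs read off the cofactor\<close>

lemma sigma_hat_eq_divisor_sum:
  "n > 0 \<Longrightarrow> sigma_hat (Suc 0) n = divisor_sum (\<lambda>d e. if even e then - real d else real d) n"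
  unfolding sigma_hat_def divisor_sum_def
  by (rule sum.cong) (auto elim!: dvdE)

text \<open>Even divisors \<open>d\<close> of \<open>n\<close> correspond to divisors \<open>d div 2\<close> with even cofactor.\<close>
lemma sigma_tilde_eq_divisor_sum:
  assumes "n > 0"
  shows "sigma_tilde s n = divisor_sum (\<lambda>d e. (if even e then 1 - 2 ^ (s + 1) else 1) * real d ^ s) n"
proof -
  \<comment> \<open>The difference cancels at odd \<open>d\<close> and doubles at even
    \<open>d\<close>; writing \<open>2 * d\<close> for an even divisor then produces the factor
    \<open>2 ^ (s + 1)\<close>.\<close>
  have "(\<Sum>d | d dvd n. real d ^ s - (-1) ^ (d - 1) * real d ^ s)
    = (\<Sum>d | d dvd n. if even d then 2 * real d ^ s else 0)"
    using assms by (intro sum.cong) (auto simp: dvd_pos_nat)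
  also have "\<dots> = (\<Sum>d | d dvd n \<and> even d. 2 * real d ^ s)"
    using assms by (simp add: sum.inter_filter[symmetric] Collect_conj_eq[symmetric])
  also have "\<dots> = (\<Sum>d | d dvd n \<and> even (n div d). 2 ^ (s + 1) * real d ^ s)"
    by (rule sum.reindex_bij_witness[where i = "\<lambda>d. 2 * d" and j = "\<lambda>d. d div 2"])
      (use assms in \<open>auto elim!: dvdE simp: power_mult_distrib\<close>)
  also have "\<dots> = (\<Sum>d | d dvd n. if even (n div d) then 2 ^ (s + 1) * real d ^ s else 0)"
    using assms by (simp add: sum.inter_filter[symmetric] Collect_conj_eq[symmetric])
  finally have "(\<Sum>d | d dvd n. real d ^ s) - sigma_tilde s n
     = (\<Sum>d | d dvd n. if even (n div d) then 2 ^ (s + 1) * real d ^ s else 0)"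
    by (simp add: sum_subtractf sigma_tilde_def)
  then have "sigma_tilde s n = (\<Sum>d | d dvd n. real d ^ s
     - (if even (n div d) then 2 ^ (s + 1) * real d ^ s else 0))"
    by (simp add: sum_subtractf)
  also have "\<dots> = divisor_sum (\<lambda>d e. (if even e then 1 - 2 ^ (s + 1) else 1) * real d ^ s) n"
    unfolding divisor_sum_def by (rule sum.cong) (auto simp: algebra_simps)
  finally show ?thesis .
qed

section \<open>Weight 4: the quadratic case\<close>

lemma sum_mult_complement:
  "(\<Sum>a \<in> {0<..<d}. real a * (real d - real a)) = (real d ^ 3 - real d) / 6"
proof (cases d)
  case (Suc m)
  \<comment> \<open>\<open>c\<close> is kept independent of the summation limit so that induction on
    \<open>m\<close> applies; afterwards \<open>c = d = m + 1\<close>.\<close>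
  have "(\<Sum>a \<in> {1..m}. real a * (c - real a))
      = c * real m * (real m + 1) / 2 - real m * (real m + 1) * (2 * real m + 1) / 6" for c
    by (induction m) (simp_all add: field_simps)
  from this[of "real d"] show ?thesis
    unfolding Suc atLeastSucLessThan_greaterThanLessThan[symmetric]
      atLeastLessThanSuc_atLeastAtMost
    by (simp add: field_simps power3_eq_cube)
qed simp

lemma sum_alternating:
  "m > 0 \<Longrightarrow> (\<Sum>x \<in> {0<..<m::nat}. if even x then 1 else - 1 :: real) = (if even m then - 1 else 0)"
proof (induction m rule: nat_induct_non_zero)
  case (Suc m)
  then have "{0<..<Suc m} = insert m {0<..<m}" by auto
  with Suc show ?case by simp
qed simp

text \<open>
  On each parity class of \<open>(x, y)\<close>, \<open>g4 a b x y\<close> is the polynomial continuation of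
  \<open>f4 (a - b) b x (x + y)\<close>, and \<open>f4 - g4\<close> is \<open>a * b\<close> up to the signs occurring in \<open>sigma_hat\<close>.
\<close>
definition f4 :: "nat \<Rightarrow> nat \<Rightarrow> nat \<Rightarrow> nat \<Rightarrow> real" where
  "f4 a b x y =
    (if even x then if even y then (a ^ 2 + a * b + b ^ 2) / 2 else - (a * (a + b)) / 2
     else if even y then - (b * (a + b)) / 2 else a * b / 2)"

definition g4 :: "nat \<Rightarrow> nat \<Rightarrow> nat \<Rightarrow> nat \<Rightarrow> real" where
  "g4 a b x y =
    (if even x then if even y then (real a ^ 2 - a * b + real b ^ 2) / 2 else a * (real b - a) / 2
     else if even y then b * (real a - b) / 2 else - (a * b) / 2)"

lemma sum_quads_weight4:
  assumes "n > 0"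
  shows "(\<Sum>(a, b, x, y) \<in> quads n. f4 a b x y - g4 a b x y)
    = (\<Sum>d | d dvd n. if even (n div d) then (5 * real d ^ 3 + real d) / 12
        else (real d ^ 3 - real d) / 12)"
proof -
  have "(\<Sum>(a, b, x, y) \<in> quads n. f4 a b x y - g4 a b x y)
    = (\<Sum>d | d dvd n. \<Sum>a \<in> {0<..<d}. f4 a (d - a) (n div d) (n div d))
      - (\<Sum>d | d dvd n. \<Sum>x \<in> {0<..<n div d}. g4 d d x (n div d - x))"
    using assms
    by (rule sum_quads_difference) (auto simp: f4_def g4_def field_simps power2_eq_square)
  also have "(\<Sum>d | d dvd n. \<Sum>a \<in> {0<..<d}. f4 a (d - a) (n div d) (n div d))
    = (\<Sum>d | d dvd n. if even (n div d) then (5 * real d ^ 3 - 6 * real d ^ 2 + real d) / 12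
        else (real d ^ 3 - real d) / 12)"
  proof (rule sum.cong)
    fix d assume "d \<in> {d. d dvd n}"
    then have "d > 0" using assms by (auto intro!: Nat.gr0I)
    have "(\<Sum>a \<in> {0<..<d}. f4 a (d - a) e e)
        = (\<Sum>a \<in> {0<..<d}. if even e then real d ^ 2 / 2 - real a * (real d - real a) / 2
            else real a * (real d - real a) / 2)" for e
      by (rule sum.cong) (auto simp: f4_def of_nat_diff field_simps power2_eq_square)
    also have "\<dots> e = (if even e then (5 * real d ^ 3 - 6 * real d ^ 2 + real d) / 12
        else (real d ^ 3 - real d) / 12)" for e
      using \<open>d > 0\<close>
      by (cases "even e"; simp add: sum_subtractf sum_divide_distrib[symmetric] sum_mult_complement)
        (simp_all add: of_nat_diff field_simps power2_eq_square power3_eq_cube)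
    finally show "(\<Sum>a \<in> {0<..<d}. f4 a (d - a) (n div d) (n div d))
      = (if even (n div d) then (5 * real d ^ 3 - 6 * real d ^ 2 + real d) / 12
        else (real d ^ 3 - real d) / 12)" .
  qed simp
  also have "(\<Sum>d | d dvd n. \<Sum>x \<in> {0<..<n div d}. g4 d d x (n div d - x))
    = (\<Sum>d | d dvd n. if even (n div d) then - (real d ^ 2) / 2 else 0)"
  proof (rule sum.cong)
    fix d assume "d \<in> {d. d dvd n}"
    then have "n div d > 0" using assms by (auto simp: dvd_div_eq_0_iff intro!: Nat.gr0I)
    \<comment> \<open>For odd \<open>e\<close> the parities of \<open>x\<close> and
      \<open>e - x\<close> differ, and \<open>g4 d d\<close> vanishes there. For even
      \<open>e\<close> they agree and the value is plus or minus \<open>d ^ 2 / 2\<close>.\<close>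
    have eq: "(\<Sum>x \<in> {0<..<e}. g4 d d x (e - x))
        = (if even e then (\<Sum>x \<in> {0<..<e}. (if even x then 1 else - 1) * (real d ^ 2 / 2)) else 0)" for e
      by (auto simp: g4_def power2_eq_square intro!: sum.cong sum.neutral)
    show "(\<Sum>x \<in> {0<..<n div d}. g4 d d x (n div d - x))
      = (if even (n div d) then - (real d ^ 2) / 2 else 0)"
      unfolding eq sum_distrib_right[symmetric] sum_alternating[OF \<open>n div d > 0\<close>] by simp
  qed simp
  \<comment> \<open>The squares of divisors cancel between the two diagonals.\<close>
  finally show ?thesis
    by (simp add: sum_subtractf[symmetric] if_distrib cong: if_cong)
      (auto intro!: sum.cong simp: field_simps)
qed

section \<open>Weight 8: the sextic case\<close>

text \<open>
  The symmetry of the functions built from a sextic form forces invariance under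
  \<open>t \<mapsto> - s - t\<close>, which leaves the cubic forms in \<open>s\<^sup>2\<close> and \<open>(s + 2 t)\<^sup>2\<close>. The four
  coefficients are the unique solution of the linear system expressed by the two lemmas on
  differences of \<open>p8\<close>.
\<close>
definition p8 :: "real \<Rightarrow> real \<Rightarrow> real" where
  "p8 s t = (123 * s ^ 6 - 231 * s ^ 4 * (s + 2 * t) ^ 2 + 45 * s ^ 2 * (s + 2 * t) ^ 4
    + 63 * (s + 2 * t) ^ 6) / 64"

text \<open>The substitution only changes the sign of \<open>s + 2 * t\<close>, which enters through
  even powers.\<close>

lemma p8_reflect: "p8 s (- s - t) = p8 s t"
proof -
  have "s + 2 * (- s - t) = - (s + 2 * t)" by simp
  then show ?thesis unfolding p8_def by (simp only: power_minus_even even_numeral)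
qed

lemma p8_minus: "p8 (- s) (- t) = p8 s t"
proof -
  have "- s + 2 * (- t) = - (s + 2 * t)" by simp
  then show ?thesis unfolding p8_def by (simp only: power_minus_even even_numeral)
qed

text \<open>The four coefficients 123, -231, 45, 63 add up to 0. This makes the diagonal
  \<open>a = b\<close> vanish for odd \<open>n\<close>.\<close>

lemma p8_zero: "p8 s 0 = 0"
  by (simp add: p8_def power_add[symmetric])

text \<open>Case \<open>x\<close> odd, \<open>y\<close> even: the right side is half the
  symmetrization of 72 times the product of cubic weights minus 12 times the product of linear and
  quintic weights. Hence 360 = 72 * 5, 378 = 6 * 63 with -63 = 1 - 2^6, and 6.\<close>

lemma p8_difference_mixed:
  "p8 a b - p8 a (- b) = 6 * a ^ 5 * b + 360 * a ^ 3 * b ^ 3 + 378 * a * b ^ 5"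
  unfolding p8_def by (simp add: field_simps) algebra

text \<open>The same combination when \<open>x\<close> and \<open>y\<close> are both odd, where all
  weights are 1.\<close>

lemma p8_difference_odd:
  "p8 (a + b) (- a) - p8 (a - b) b = 72 * a ^ 3 * b ^ 3 - 6 * (a * b ^ 5 + a ^ 5 * b)"
  unfolding p8_def by (simp add: field_simps) algebra

text \<open>The leading coefficient is the integral of \<open>p8 1 (- t)\<close> over
  \<open>t\<close> from 0 to 1, namely (123 - 231/3 + 45/5 + 63/7) / 64 = 1. So seventh powers of
  divisors appear with coefficient 1.\<close>

lemma sum_p8: "(\<Sum>a \<in> {0<..<d}. p8 (real d) (- real a))
    = real d ^ 7 + real d ^ 5 / 2 - 3 * real d ^ 3 + 3 / 2 * real d"
proof (cases d)
  case (Suc m)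
  \<comment> \<open>Power sum formulas applied to each coefficient of \<open>c\<close>, which again
    stays independent of \<open>m\<close> until \<open>c = d = m + 1\<close>.\<close>
  have "(\<Sum>a \<in> {1..m}. p8 c (- real a)) = (let x = real m in
      (3/2) * x + (-21/2) * x^3 + (63/2) * x^5 + (63/2) * x^6 + 9 * x^7
      + c * ((63/4) * x^2 + (-315/4) * x^4 + (-189/2) * x^5 + (-63/2) * x^6)
      + c^2 * ((-33/4) * x + (165/2) * x^3 + (495/4) * x^4 + (99/2) * x^5)
      + c^3 * ((-45) * x^2 + (-90) * x^3 + (-45) * x^4)
      + c^4 * ((41/4) * x + (123/4) * x^2 + (41/2) * x^3) + c^5 * ((-3/2) * x + (-3/2) * x^2))" for c
  proof (induction m)
    case (Suc m)
    then show ?case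
      unfolding Let_def p8_def by (simp add: field_simps) algebra
  qed simp
  from this[of "real d"] show ?thesis
    unfolding Suc atLeastSucLessThan_greaterThanLessThan[symmetric] Let_def
      atLeastLessThanSuc_atLeastAtMost
    by (simp add: field_simps) algebra
qed simp

text \<open>
  The class where \<open>x\<close> and \<open>y\<close> are both even does not occur for odd \<open>n\<close>, so its value is arbitrary.
\<close>
definition f8 :: "nat \<Rightarrow> nat \<Rightarrow> nat \<Rightarrow> nat \<Rightarrow> real" where
  "f8 a b x y = (if even x then p8 b a else if even y then p8 a b else p8 (real a + b) (- real a))"

definition g8 :: "nat \<Rightarrow> nat \<Rightarrow> nat \<Rightarrow> nat \<Rightarrow> real" where
  "g8 a b x y =
    (if even x then p8 b (real a - b) else if even y then p8 a (real b - a) else p8 (real a - b) b)"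

lemma sum_quads_weight8:
  assumes "odd n"
  shows "(\<Sum>(a, b, x, y) \<in> quads n. f8 a b x y - g8 a b x y)
    = (\<Sum>d | d dvd n. real d ^ 7 + real d ^ 5 / 2 - 3 * real d ^ 3 + 3 / 2 * real d)"
proof -
  have odd_div: "odd (n div d)" if "d dvd n" for d
    using that assms by (metis dvd_div_mult_self even_mult_iff)
  have "n > 0" using assms by (cases n) auto
  then have "(\<Sum>(a, b, x, y) \<in> quads n. f8 a b x y - g8 a b x y)
    = (\<Sum>d | d dvd n. \<Sum>a \<in> {0<..<d}. f8 a (d - a) (n div d) (n div d))
      - (\<Sum>d | d dvd n. \<Sum>x \<in> {0<..<n div d}. g8 d d x (n div d - x))"
  proof (rule sum_quads_difference)
    fix a b x y assume q: "(a, b, x, y) \<in> quads n"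
    then have "odd x \<or> odd y" using assms by auto
    \<comment> \<open>Swapping exchanges the two mixed parity classes by definition; only the class
      with \<open>x\<close> and \<open>y\<close> both odd needs the invariance of
      \<open>p8\<close>.\<close>
    moreover have "p8 (real a + b) (- real a) = p8 (real b + a) (- real b)"
      using p8_reflect[of "real a + b" "- real b"] by (simp add: add.commute)
    moreover have "p8 (real a - b) b = p8 (real b - a) a"
      using p8_reflect[of "real a - b" "real b"] p8_minus[of "real b - a" "real a"] by simp
    ultimately show "f8 a b x y = f8 b a y x" "g8 a b x y = g8 b a y x"
      by (auto simp: f8_def g8_def)
  next
    fix a b x y assume q: "(a + b, b, x, y) \<in> quads n"
    then have "odd x \<or> odd y" using assms by auto
    moreover have "p8 (real a + b) (- real a) = p8 (real a + b) (- real b)"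
      using p8_reflect[of "real a + b" "- real b"] by simp
    ultimately show "g8 (a + b) b x y = f8 a b x (x + y)"
      by (auto simp: f8_def g8_def)
  qed
  \<comment> \<open>Cofactors are odd, so \<open>x\<close> and \<open>n div d - x\<close> have
    opposite parity and every term is \<open>p8 d 0\<close>.\<close>
  also have "(\<Sum>d | d dvd n. \<Sum>x \<in> {0<..<n div d}. g8 d d x (n div d - x)) = 0"
    using odd_div by (intro sum.neutral ballI) (auto simp: g8_def p8_zero)
  also have "(\<Sum>d | d dvd n. \<Sum>a \<in> {0<..<d}. f8 a (d - a) (n div d) (n div d))
    = (\<Sum>d | d dvd n. \<Sum>a \<in> {0<..<d}. p8 (real d) (- real a))"
    using odd_div by (intro sum.cong refl) (auto simp: f8_def)
  finally show ?thesis by (simp add: sum_p8)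
qed

section \<open>Evaluation of the two convolutions\<close>

lemma convolution_sigma_hat:
  fixes n :: nat and sh :: "nat \<Rightarrow> real"
  assumes sh: "sh = (sigma_hat 1)(0 := 1 / 24)"
  shows "(\<Sum>(i, j) \<in> {(i, j). i + j = n}. sh i * sh j)
    = ((\<lambda>m. divisor_sum (\<lambda>d e. (if even e then 5 else 1) * real d ^ 3) m / 12)(0 := 1 / 576)) n"
proof (cases "n = 0")
  case True
  have "{(i, j). i + j = (0::nat)} = {(0, 0)}" by auto
  with True sh show ?thesis by simp
next
  case False
  let ?h = "\<lambda>d e. if even e then - real d else real d"
  have "(\<Sum>(i, j) \<in> {(i, j). 0 < i \<and> 0 < j \<and> i + j = n}. sh i * sh j)
    = (\<Sum>(i, j) \<in> {(i, j). 0 < i \<and> 0 < j \<and> i + j = n}. divisor_sum ?h i * divisor_sum ?h j)"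
    by (rule sum.cong) (auto simp: sh sigma_hat_eq_divisor_sum)
  also have "\<dots> = (\<Sum>(a, b, x, y) \<in> quads n. ?h a x * ?h b y)"
    using False by (simp add: convolution_divisor_sum)
  also have "\<dots> = (\<Sum>(a, b, x, y) \<in> quads n. f4 a b x y - g4 a b x y)"
    by (rule sum.cong) (auto simp: f4_def g4_def field_simps power2_eq_square)
  also have "\<dots> = (\<Sum>d | d dvd n. if even (n div d) then (5 * real d ^ 3 + real d) / 12
        else (real d ^ 3 - real d) / 12)"
    using False by (simp add: sum_quads_weight4)
  \<comment> \<open>The two boundary terms have total weight 2 / 24 = 1 / 12, exactly what cancels
    the linear terms in \<open>d\<close> and leaves cubes only.\<close>
  finally have "(\<Sum>(i, j) \<in> {(i, j). i + j = n}. sh i * sh j)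
      = divisor_sum ?h n / 12 + (\<Sum>d | d dvd n. if even (n div d) then (5 * real d ^ 3 + real d) / 12
        else (real d ^ 3 - real d) / 12)"
    using False by (simp add: convolution_split_zero sh sigma_hat_eq_divisor_sum)
  also have "\<dots> = divisor_sum (\<lambda>d e. (if even e then 5 else 1) * real d ^ 3) n / 12"
    unfolding divisor_sum_def sum_divide_distrib sum.distrib[symmetric]
    by (rule sum.cong) (auto simp: field_simps)
  finally show ?thesis using False by simp
qed

theorem theorem3p8:
  fixes n :: nat and sh st5 :: "nat \<Rightarrow> real"
  assumes "n > 0" and "odd n"
    and "sh = (sigma_hat 1)(0 := 1 / 24)"
    and "st5 = (sigma_tilde 5)(0 := 1 / 8)"
  shows "sigma 7 n =
    12 * (864 * (\<Sum>(i, j, k, l) \<in> {(i, j, k, l). i + j + k + l = n}. sh i * sh j * sh k * sh l)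
          - (\<Sum>(i, j) \<in> {(i, j). i + j = n}. sh i * st5 j))"
proof -
  let ?pos = "{(i, j). 0 < i \<and> 0 < j \<and> i + j = n}"
  let ?t = "\<lambda>d e. (if even e then 5 else 1) * real d ^ 3"
  let ?h = "\<lambda>d e. if even e then - real d else real d"
  let ?s = "\<lambda>d e. (if even e then 1 - 2 ^ (5 + 1) else 1) * real d ^ 5"
  \<comment> \<open>72 = 12 * 864 / 144, where 144 comes from the two denominators 12 in
    \<open>?Q\<close>; 12 is the outer factor of the claim.\<close>
  let ?\<tau> = "\<lambda>a b x y. 72 * (?t a x * ?t b y) - 12 * (?h a x * ?s b y)"
  let ?Q = "(\<lambda>m. divisor_sum ?t m / 12)(0 := 1 / 576)"
  let ?T = "\<Sum>(a, b, x, y) \<in> quads n. ?t a x * ?t b y"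
  let ?H = "\<Sum>(a, b, x, y) \<in> quads n. ?h a x * ?s b y"
  have odd_div: "odd (n div d)" if "d dvd n" for d
    using that assms(2) by (metis dvd_div_mult_self even_mult_iff)
  have "(\<Sum>(i, j, k, l) \<in> {(i, j, k, l). i + j + k + l = n}. sh i * sh j * sh k * sh l)
    = (\<Sum>(u, v) \<in> {(u, v). u + v = n}. ?Q u * ?Q v)"
    by (simp only: sum_four_split convolution_sigma_hat[OF assms(3)])
  \<comment> \<open>1 / 3456 = 2 * (1 / 576) * (1 / 12) comes from the two boundary terms.\<close>
  also have "\<dots> = divisor_sum ?t n / 3456 + (\<Sum>(u, v) \<in> ?pos. ?Q u * ?Q v)"
    using assms(1) by (simp add: convolution_split_zero)
  also have "(\<Sum>(u, v) \<in> ?pos. ?Q u * ?Q v)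
    = (\<Sum>(u, v) \<in> ?pos. divisor_sum ?t u * divisor_sum ?t v) / 144"
    unfolding sum_divide_distrib by (rule sum.cong) auto
  also have "(\<Sum>(u, v) \<in> ?pos. divisor_sum ?t u * divisor_sum ?t v) = ?T"
    using assms(1) by (rule convolution_divisor_sum)
  finally have four: "(\<Sum>(i, j, k, l) \<in> {(i, j, k, l). i + j + k + l = n}. sh i * sh j * sh k * sh l)
    = divisor_sum ?t n / 3456 + ?T / 144" .
  have "(\<Sum>(i, j) \<in> {(i, j). i + j = n}. sh i * st5 j)
    = st5 n / 24 + sh n / 8 + (\<Sum>(i, j) \<in> ?pos. sh i * st5 j)"
    using assms by (simp add: convolution_split_zero)
  also have "(\<Sum>(i, j) \<in> ?pos. sh i * st5 j)
    = (\<Sum>(i, j) \<in> ?pos. divisor_sum ?h i * divisor_sum ?s j)"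
    by (rule sum.cong) (auto simp: assms(3,4) sigma_hat_eq_divisor_sum sigma_tilde_eq_divisor_sum)
  also have "\<dots> = ?H"
    using assms(1) by (rule convolution_divisor_sum)
  finally have two: "(\<Sum>(i, j) \<in> {(i, j). i + j = n}. sh i * st5 j)
    = st5 n / 24 + sh n / 8 + ?H" .
  \<comment> \<open>\<open>?\<tau>\<close> is not symmetric while \<open>f8 - g8\<close> is, so the
    two are compared after symmetrizing.\<close>
  have "2 * (\<Sum>(a, b, x, y) \<in> quads n. f8 a b x y - g8 a b x y)
    = (\<Sum>(a, b, x, y) \<in> quads n. ?\<tau> a b x y + ?\<tau> b a y x)"
    unfolding sum_distrib_left
  proof (rule sum.cong)
    fix q assume "q \<in> quads n"
    moreover obtain a b x y where q: "q = (a, b, x, y)" by (cases q)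
    ultimately have "odd x \<or> odd y" using assms(2) by auto
    \<comment> \<open>Reflection turns the argument \<open>real a - b\<close> into
      \<open>- real a\<close>.\<close>
    moreover have "2 * (p8 b a - p8 b (real a - b))
        = 12 * real b ^ 5 * a + 720 * real b ^ 3 * a ^ 3 + 756 * b * real a ^ 5"
      using p8_difference_mixed[of b a] p8_reflect[of b "real a - b"] by simp
    moreover have "2 * (p8 a b - p8 a (real b - a))
        = 12 * real a ^ 5 * b + 720 * real a ^ 3 * b ^ 3 + 756 * a * real b ^ 5"
      using p8_difference_mixed[of a b] p8_reflect[of a "real b - a"] by simp
    ultimately show "2 * (case q of (a, b, x, y) \<Rightarrow> f8 a b x y - g8 a b x y)
      = (case q of (a, b, x, y) \<Rightarrow> ?\<tau> a b x y + ?\<tau> b a y x)"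
      using p8_difference_odd[of a b] by (auto simp: q f8_def g8_def algebra_simps)
  qed simp
  also have "\<dots> = (\<Sum>(a, b, x, y) \<in> quads n. ?\<tau> a b x y) + (\<Sum>(a, b, x, y) \<in> quads n. ?\<tau> b a y x)"
    by (simp only: case_prod_unfold sum.distrib)
  also have "(\<Sum>(a, b, x, y) \<in> quads n. ?\<tau> b a y x) = (\<Sum>(a, b, x, y) \<in> quads n. ?\<tau> a b x y)"
    by (rule sum_quads_swap[of ?\<tau>])
  also have "(\<Sum>(a, b, x, y) \<in> quads n. ?\<tau> a b x y) = 72 * ?T - 12 * ?H"
    by (simp add: case_prod_unfold sum_subtractf sum_distrib_left)
  finally have "72 * ?T - 12 * ?H
    = (\<Sum>d | d dvd n. real d ^ 7 + real d ^ 5 / 2 - 3 * real d ^ 3 + 3 / 2 * real d)"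
    using sum_quads_weight8[OF assms(2)] by simp
  moreover have "divisor_sum ?t n = (\<Sum>d | d dvd n. real d ^ 3)"
    unfolding divisor_sum_def using odd_div by (intro sum.cong) auto
  moreover have "sh n = (\<Sum>d | d dvd n. real d)"
    using assms(1,3) odd_div
    by (auto simp: sigma_hat_eq_divisor_sum divisor_sum_def intro!: sum.cong)
  moreover have "st5 n = (\<Sum>d | d dvd n. real d ^ 5)"
    using assms(1,4) odd_div
    by (auto simp: sigma_tilde_eq_divisor_sum divisor_sum_def intro!: sum.cong)
  ultimately have "72 * ?T - 12 * ?H
    = sigma 7 n + st5 n / 2 - 3 * divisor_sum ?t n + 3 / 2 * sh n"
    by (simp add: sigma_def sum.distrib sum_subtractf sum_distrib_left sum_divide_distrib)
  \<comment> \<open>After multiplication by 12 the boundary terms are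
    \<open>3 * divisor_sum ?t n - st5 n / 2 - 3 / 2 * sh n\<close>, which cancel everything but
    \<open>sigma 7 n\<close>.\<close>
  then show ?thesis
    unfolding four two by (simp add: algebra_simps)
qed

end
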